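(* Let $\lambda$ be a nonzero real number. For all integers $n\ge0$, \[ 2^{n}\,\beta_{n,\frac{\lambda}{2}}\!\left(\frac{x}{2}\right)=\sum_{k=0}^{n}\binom{n}{k}\beta_{k,\lambda}\,\mathcal{E}_{n-k,\lambda}(x). \]
   Context: For a nonzero real $\mu$ and any $x$, set $(x)_{0,\mu}=1$ and $(x)_{n,\mu}=x(x-\mu)\cdots(x-(n-1)\mu)$ for $n\ge1$. The degenerate exponential is $e_{\mu}^{x}(t)=\sum_{k\ge0}(x)_{k,\mu}\frac{t^k}{k!}$ ($=(1+\mu t)^{x/\mu}$), $e_\mu(t)=e_\mu^1(t)$. Degenerate Bernoulli and Euler polynomials: $\frac{t}{e_\mu(t)-1}e_\mu^x(t)=\sum_{n\ge0}\beta_{n,\mu}(x)\frac{t^n}{n!}$ and $\frac{2}{e_\mu(t)+1}e_\mu^x(t)=\sum_{n\ge0}\mathcal{E}_{n,\mu}(x)\frac{t^n}{n!}$; degenerate Bernoulli numbers $\beta_{n,\mu}=\beta_{n,\mu}(0)$. (These are used with $\mu=\lambda$ and $\mu=\lambda/2$.) *)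

theory Defs
  imports Complex_Main "HOL-Computational_Algebra.Formal_Power_Series"
begin

definition degen_fact :: "'a::field_char_0 \<Rightarrow> nat \<Rightarrow> 'a \<Rightarrow> 'a" where
  "degen_fact x n \<mu> = (\<Prod>i<n. x - of_nat i * \<mu>)"

text \<open>The formal power series in \<open>t\<close>, with \<open>e\<^sub>\<mu>(t)\<close> being \<open>degen_exp \<mu> 1\<close>.\<close>

definition degen_exp :: "'a::field_char_0 \<Rightarrow> 'a \<Rightarrow> 'a fps" where
  "degen_exp \<mu> x = Abs_fps (\<lambda>k. degen_fact x k \<mu> / fact k)"

text \<open>
  Both families are read off from their exponential generating functions. The denominator
  \<open>degen_exp \<mu> 1 - 1\<close> has zero constant term, but the division of formal power series cancels the
  common factor \<open>t\<close>, so the quotient is the intended one; see \<open>degen_bernoulli_quotient\<close> below.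
\<close>

definition degen_bernoulli :: "nat \<Rightarrow> 'a::field_char_0 \<Rightarrow> 'a \<Rightarrow> 'a" where
  "degen_bernoulli n \<mu> x =
     fact n * fps_nth (fps_X / (degen_exp \<mu> 1 - 1) * degen_exp \<mu> x) n"

definition degen_euler :: "nat \<Rightarrow> 'a::field_char_0 \<Rightarrow> 'a \<Rightarrow> 'a" where
  "degen_euler n \<mu> x =
     fact n * fps_nth (2 / (degen_exp \<mu> 1 + 1) * degen_exp \<mu> x) n"

definition degen_bernoulli_number :: "nat \<Rightarrow> 'a::field_char_0 \<Rightarrow> 'a" where
  "degen_bernoulli_number n \<mu> = degen_bernoulli n \<mu> 0"

lemma subdegree_degen_exp_minus_1: "subdegree (degen_exp \<mu> 1 - 1) = 1"
  by (rule subdegreeI) (simp_all add: degen_exp_def degen_fact_def)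

lemma degen_bernoulli_quotient:
  "fps_X / (degen_exp \<mu> 1 - 1) * (degen_exp \<mu> 1 - 1) = (fps_X :: 'a::field_char_0 fps)"
proof -
  have "degen_exp \<mu> (1::'a) - 1 \<noteq> 0"
    using subdegree_degen_exp_minus_1[of \<mu>] by (metis subdegree_0 zero_neq_one)
  then have "(degen_exp \<mu> 1 - 1 :: 'a fps) dvd fps_X"
    by (simp add: fps_dvd_iff subdegree_degen_exp_minus_1[simplified])
  then show ?thesis by (rule dvd_div_mult_self)
qed

lemma degen_euler_quotient:
  "2 / (degen_exp \<mu> 1 + 1) * (degen_exp \<mu> 1 + 1) = (2 :: 'a::field_char_0 fps)"
proof (rule dvd_div_mult_self)
  have "fps_nth (degen_exp \<mu> (1::'a) + 1) 0 = 2"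
    by (simp add: degen_exp_def degen_fact_def)
  then have "is_unit (degen_exp \<mu> 1 + 1 :: 'a fps)"
    by (simp add: fps_is_unit_iff)
  then show "(degen_exp \<mu> 1 + 1 :: 'a fps) dvd 2" by (rule unit_imp_dvd)
qed

end

theory Submission
  imports Defs
begin

text \<open>
  Rescaling gives \<open>degen_exp (\<mu> / 2) (x / 2) (2 t) = degen_exp \<mu> x t\<close>, and in particular
  \<open>degen_exp (\<mu> / 2) 1 (2 t) = degen_exp \<mu> 2 t = (degen_exp \<mu> 1 t)\<^sup>2\<close>. Writing \<open>e\<close> for
  \<open>degen_exp \<mu> 1\<close>, the identity is the coefficientwise form of
  \<open>2 t / (e\<^sup>2 - 1) = t / (e - 1) * (2 / (e + 1))\<close>, multiplied by \<open>degen_exp \<mu> x\<close>.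
\<close>

lemma degen_exp_0: "degen_exp \<mu> 0 = (1 :: 'a::field_char_0 fps)"
proof (rule fps_ext)
  fix n
  show "fps_nth (degen_exp \<mu> (0::'a)) n = fps_nth 1 n"
    by (cases n) (auto simp: degen_exp_def degen_fact_def prod.lessThan_Suc_shift)
qed

lemma degen_fact_scale:
  "degen_fact (c * x) n (c * \<mu>) = c ^ n * degen_fact (x :: 'a::field_char_0) n \<mu>"
proof -
  have "degen_fact (c * x) n (c * \<mu>) = (\<Prod>i<n. c * (x - of_nat i * \<mu>))"
    unfolding degen_fact_def by (simp add: algebra_simps)
  then show ?thesis
    by (simp add: degen_fact_def prod.distrib)
qed

lemma degen_exp_scale:
  "degen_exp \<mu> x oo (fps_const c * fps_X) = degen_exp (c * \<mu>) (c * (x :: 'a::field_char_0))"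
  by (rule fps_ext) (simp add: fps_compose_linear degen_exp_def degen_fact_scale)

text \<open>This is the formal version of (1 + \<mu>t)^(x/\<mu>). For step 1 the degenerate
  factorial is the falling factorial, so the series is binomial; rescaling t by \<mu> gives the
  general step.\<close>

lemma degen_exp_eq_fps_binomial:
  assumes "\<mu> \<noteq> 0"
  shows "degen_exp \<mu> x = fps_binomial (x / \<mu>) oo (fps_const (\<mu> :: 'a::field_char_0) * fps_X)"
proof -
  have "degen_exp 1 y = fps_binomial y" for y :: 'a
    by (rule fps_ext) (simp add: degen_exp_def degen_fact_def gbinomial_prod_rev atLeast0LessThan)
  then show ?thesis
    using degen_exp_scale[of 1 "x / \<mu>" \<mu>] assms by simp
qed

text \<open>Binomial series multiply by adding exponents (Vandermonde), and substituting \<mu>t,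
  which has no constant term, preserves products.\<close>

lemma degen_exp_add:
  assumes "\<mu> \<noteq> (0 :: 'a::field_char_0)"
  shows "degen_exp \<mu> (x + y) = degen_exp \<mu> x * degen_exp \<mu> y"
  by (simp add: degen_exp_eq_fps_binomial[OF assms] add_divide_distrib fps_binomial_add_mult
      fps_compose_mult_distrib)

text \<open>The factor \<open>degen_exp \<mu> 0\<close>, equal to 1, is kept so that the first
  factor on the right is literally the generating function of the Bernoulli numbers.\<close>

lemma bernoulli_egf_scale_2:
  assumes "\<mu> \<noteq> (0 :: 'a::field_char_0)"
  shows "(fps_X / (degen_exp (\<mu> / 2) 1 - 1) * degen_exp (\<mu> / 2) (x / 2)) oo (fps_const 2 * fps_X)
    = (fps_X / (degen_exp \<mu> 1 - 1) * degen_exp \<mu> 0) * (2 / (degen_exp \<mu> 1 + 1) * degen_exp \<mu> x)"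
proof -
  define e where "e = degen_exp \<mu> 1"
  define s :: "'a fps" where "s = fps_const 2 * fps_X"
  define B where "B = fps_X / (degen_exp (\<mu> / 2) 1 - 1)"
  have s0: "fps_nth s 0 = 0"
    by (simp add: s_def)
  \<comment> \<open>The exponent 2 is written as 1 + 1 to match the addition law.\<close>
  have "degen_exp (\<mu> / 2) 1 oo s = degen_exp \<mu> (1 + 1)"
    by (simp add: s_def degen_exp_scale)
  then have "degen_exp (\<mu> / 2) 1 oo s = e * e"
    by (simp only: degen_exp_add[OF assms] e_def)
  \<comment> \<open>Substitute into the equation characterising the quotient \<open>B\<close>, not
    into the quotient itself: this involves only products and differences.\<close>
  moreover have "(B * (degen_exp (\<mu> / 2) 1 - 1)) oo s = fps_X oo s"
    unfolding B_def by (simp only: degen_bernoulli_quotient)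
  ultimately have "(B oo s) * ((e - 1) * (e + 1)) = 2 * fps_X"
    by (simp add: fps_compose_mult_distrib[OF s0] fps_compose_sub_distrib s0)
       (simp add: s_def algebra_simps numeral_fps_const)
  \<comment> \<open>Expand both factors of \<open>2 * fps_X\<close> by their quotient equations, so
    that (e - 1)(e + 1) can be cancelled from both sides.\<close>
  also have "\<dots> = (fps_X / (e - 1) * (e - 1)) * (2 / (e + 1) * (e + 1))"
    unfolding e_def degen_bernoulli_quotient degen_euler_quotient by (rule mult.commute)
  also have "\<dots> = fps_X / (e - 1) * (2 / (e + 1)) * ((e - 1) * (e + 1))"
    by (simp only: mult_ac)
  finally have eq: "(B oo s) * ((e - 1) * (e + 1)) =
      fps_X / (e - 1) * (2 / (e + 1)) * ((e - 1) * (e + 1))" .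
  \<comment> \<open>\<open>e - 1\<close> has zero constant term and is no unit, but being nonzero
    suffices to cancel it in an integral domain.\<close>
  have "e - 1 \<noteq> 0"
    using degen_bernoulli_quotient[of \<mu>] unfolding e_def by (metis fps_X_neq_zero mult_zero_right)
  moreover have "e + 1 \<noteq> 0"
    using degen_euler_quotient[of \<mu>] unfolding e_def by (metis mult_zero_right zero_neq_numeral)
  ultimately have "B oo s = fps_X / (e - 1) * (2 / (e + 1))"
    using eq by (metis mult_eq_0_iff mult_right_cancel)
  moreover have "degen_exp (\<mu> / 2) (x / 2) oo s = degen_exp \<mu> x"
    by (simp add: s_def degen_exp_scale)
  ultimately show ?thesis
    unfolding B_def[symmetric] s_def[symmetric] e_def[symmetric]
    by (simp add: fps_compose_mult_distrib[OF s0] degen_exp_0 mult_ac)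
qed

theorem theorem2p7:
  fixes l :: real and x :: "'a::real_field" and n :: nat
  assumes "l \<noteq> 0"
  shows "2 ^ n * degen_bernoulli n (of_real (l / 2)) (x / 2) =
    (\<Sum>k=0..n. of_nat (n choose k) * degen_bernoulli_number k (of_real l)
                 * degen_euler (n - k) (of_real l) x)"
proof -
  define \<mu> :: 'a where "\<mu> = of_real l"
  have "\<mu> \<noteq> 0"
    using assms by (simp add: \<mu>_def)
  define F where "F = fps_X / (degen_exp (\<mu> / 2) 1 - 1) * degen_exp (\<mu> / 2) (x / 2)"
  define G where "G = fps_X / (degen_exp \<mu> 1 - 1) * degen_exp \<mu> 0"
  define H where "H = 2 / (degen_exp \<mu> 1 + 1) * degen_exp \<mu> x"
  \<comment> \<open>Replacing t by 2t multiplies the n-th coefficient by 2^n, which accounts for the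
    power of 2.\<close>
  have "2 ^ n * degen_bernoulli n (\<mu> / 2) (x / 2) = fact n * fps_nth (F oo (fps_const 2 * fps_X)) n"
    unfolding fps_compose_linear by (simp add: degen_bernoulli_def F_def)
  also have "F oo (fps_const 2 * fps_X) = G * H"
    unfolding F_def G_def H_def by (rule bernoulli_egf_scale_2) fact
  also have "fact n * fps_nth (G * H) n = (\<Sum>k=0..n. fact n * (fps_nth G k * fps_nth H (n - k)))"
    by (simp add: fps_mult_nth sum_distrib_left)
  also have "\<dots> = (\<Sum>k=0..n. of_nat (n choose k) * degen_bernoulli_number k \<mu>
                 * degen_euler (n - k) \<mu> x)"
  proof (rule sum.cong)
    fix k assume "k \<in> {0..n}"
    then have "of_nat (n choose k) = (fact n / (fact k * fact (n - k)) :: 'a)"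
      by (intro binomial_fact) simp
    then show "fact n * (fps_nth G k * fps_nth H (n - k)) =
        of_nat (n choose k) * degen_bernoulli_number k \<mu> * degen_euler (n - k) \<mu> x"
      by (simp add: degen_bernoulli_number_def degen_bernoulli_def degen_euler_def
          flip: G_def H_def)
  qed simp
  finally show ?thesis
    by (simp add: \<mu>_def)
qed

end
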